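(* For any ditree $T$, $\rho(T)=\gamma(T)$.
   Context: All digraphs are finite, and their arc relation is irreflexive (no loops); both arcs $uv$ and $vu$ may be present. For a digraph $D$ and vertex $v$, $N^+_D(v)$ is the set of out-neighbors of $v$ (vertices $w$ with $vw$ an arc), $N^+_D[v]=N^+_D(v)\cup\{v\}$, $N^-_D(v)$ is the set of in-neighbors of $v$, and $N^-_D[v]=N^-_D(v)\cup\{v\}$. The underlying graph of $D$ is the undirected graph on $V(D)$ in which $u,v$ are adjacent iff at least one of the arcs $uv$, $vu$ is in $D$. A ditree is a digraph whose underlying graph is a tree. A set $S\subseteq V(D)$ is dominating if $\bigcup_{v\in S}N^+_D[v]=V(D)$; $\gamma(D)$ is the minimum size of a dominating set. A set $P\subseteq V(D)$ is a packing if $N^-_D[x]\cap N^-_D[y]=\emptyset$ for all distinct $x,y\in P$; $\rho(D)$ is the maximum size of a packing. *)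

theory Defs
  imports "Graph_Theory.Graph_Theory"
begin

text \<open>
  A finite loopless digraph without parallel arcs is a record satisfying the locale
  predicate \<^const>\<open>pair_digraph\<close>: a vertex set together with an irreflexive arc relation on it.
  The undirected graph underlying it is encoded by \<^const>\<open>mk_symmetric\<close>, in which each edge
  appears as a pair of opposite arcs.
\<close>

definition out_nbs :: "'a pair_pre_digraph \<Rightarrow> 'a \<Rightarrow> 'a set" where
  "out_nbs D v = {w \<in> pverts D. (v, w) \<in> parcs D}"

definition closed_out_nbs :: "'a pair_pre_digraph \<Rightarrow> 'a \<Rightarrow> 'a set" where
  "closed_out_nbs D v = out_nbs D v \<union> {v}"

definition in_nbs :: "'a pair_pre_digraph \<Rightarrow> 'a \<Rightarrow> 'a set" where
  "in_nbs D v = {u \<in> pverts D. (u, v) \<in> parcs D}"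

definition closed_in_nbs :: "'a pair_pre_digraph \<Rightarrow> 'a \<Rightarrow> 'a set" where
  "closed_in_nbs D v = in_nbs D v \<union> {v}"

text \<open>
  The library constant \<^const>\<open>tree\<close> is not usable for undirected graphs in this encoding: it
  forbids every directed cycle, and each undirected edge already gives a directed cycle of
  length 2. The cycles of the undirected graph are those of length at least 3. As in the
  library, a connected graph is nonempty.
\<close>

definition undirected_tree :: "'a pair_pre_digraph \<Rightarrow> bool" where
  "undirected_tree G \<longleftrightarrow> pair_graph G \<and> Digraph_Component.connected (with_proj G) \<and>
     \<not> (\<exists>p. pre_digraph.cycle (with_proj G) p \<and> 3 \<le> length p)"

definition ditree :: "'a pair_pre_digraph \<Rightarrow> bool" where
  "ditree D \<longleftrightarrow> pair_digraph D \<and> undirected_tree (mk_symmetric (with_proj D))"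

definition dominating :: "'a pair_pre_digraph \<Rightarrow> 'a set \<Rightarrow> bool" where
  "dominating D S \<longleftrightarrow> S \<subseteq> pverts D \<and> (\<Union>v\<in>S. closed_out_nbs D v) = pverts D"

definition packing :: "'a pair_pre_digraph \<Rightarrow> 'a set \<Rightarrow> bool" where
  "packing D P \<longleftrightarrow> P \<subseteq> pverts D \<and>
     (\<forall>x\<in>P. \<forall>y\<in>P. x \<noteq> y \<longrightarrow> closed_in_nbs D x \<inter> closed_in_nbs D y = {})"

definition domination_number :: "'a pair_pre_digraph \<Rightarrow> nat" where
  "domination_number D = Min (card ` {S. dominating D S})"

definition packing_number :: "'a pair_pre_digraph \<Rightarrow> nat" where
  "packing_number D = Max (card ` {P. packing D P})"

text \<open>The sets whose minimum and maximum are taken are finite and nonempty.\<close>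

lemma dominating_finite_nonempty:
  assumes "pair_digraph D"
  shows "finite {S. dominating D S}" "{S. dominating D S} \<noteq> {}"
proof -
  have "finite (pverts D)"
    using assms by (simp add: pair_digraph_def pair_fin_digraph_def pair_fin_digraph_axioms_def)
  then show "finite {S. dominating D S}"
    by (rule_tac finite_subset[of _ "Pow (pverts D)"]) (auto simp: dominating_def)
  have "dominating D (pverts D)"
    by (auto simp: dominating_def closed_out_nbs_def out_nbs_def)
  then show "{S. dominating D S} \<noteq> {}" by blast
qed

lemma packing_finite_nonempty:
  assumes "pair_digraph D"
  shows "finite {P. packing D P}" "{P. packing D P} \<noteq> {}"
proof -
  have "finite (pverts D)"
    using assms by (simp add: pair_digraph_def pair_fin_digraph_def pair_fin_digraph_axioms_def)
  then show "finite {P. packing D P}"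
    by (rule_tac finite_subset[of _ "Pow (pverts D)"]) (auto simp: packing_def)
  have "packing D {}" by (simp add: packing_def)
  then show "{P. packing D P} \<noteq> {}" by blast
qed

end

theory Submission
  imports Defs
begin

text \<open>
  A set dominates iff it meets every closed in-neighborhood, and a packing is a set of vertices
  with disjoint closed in-neighborhoods, so the claim is a min-max equality for the family of
  closed in-neighborhoods. Root the underlying tree; each closed in-neighborhood is a subtree and
  has a top vertex. A subtree meeting one whose top is at least as deep contains that top.
  Hence one may greedily pack the subtree with the deepest top, put this top into the
  dominating set, and discard all subtrees containing it.
\<close>

section \<open>Greedy packing in a finite family of sets\<close>

text \<open>Trees enter only through \<open>meet\<close>, where \<open>t i\<close> is the top of
  \<open>F i\<close> and \<open>d\<close> is depth. Taking the transversal as the image of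
  \<open>P\<close> under \<open>t\<close> keeps it no larger than \<open>P\<close>.\<close>

lemma disjoint_family_with_transversal:
  fixes F :: "'i \<Rightarrow> 'a set" and t :: "'i \<Rightarrow> 'a" and d :: "'a \<Rightarrow> nat"
  assumes "finite I"
    and top: "\<And>i. i \<in> I \<Longrightarrow> t i \<in> F i"
    and meet: "\<And>i j. i \<in> I \<Longrightarrow> j \<in> I \<Longrightarrow> F i \<inter> F j \<noteq> {} \<Longrightarrow> d (t j) \<le> d (t i) \<Longrightarrow> t i \<in> F j"
  shows "\<exists>P\<subseteq>I. (\<forall>i\<in>P. \<forall>j\<in>P. i \<noteq> j \<longrightarrow> F i \<inter> F j = {}) \<and> (\<forall>i\<in>I. F i \<inter> t ` P \<noteq> {})"
  using assms
proof (induction I rule: finite_psubset_induct)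
  case (psubset I)
  show ?case
  proof (cases "I = {}")
    case False
    then have "Max ((\<lambda>i. d (t i)) ` I) \<in> (\<lambda>i. d (t i)) ` I"
      using psubset.hyps by (intro Max_in) auto
    then obtain i where "i \<in> I" "d (t i) = Max ((\<lambda>i. d (t i)) ` I)" by auto
    then have i: "i \<in> I" "\<And>j. j \<in> I \<Longrightarrow> d (t j) \<le> d (t i)"
      using psubset.hyps by auto
    \<comment> \<open>Sets outside \<open>?J\<close> are hit by \<open>t i\<close>; by
      \<open>meet\<close> and the maximal depth of \<open>t i\<close>, those in \<open>?J\<close>
      are disjoint from \<open>F i\<close>.\<close>
    let ?J = "{j \<in> I. t i \<notin> F j}"
    have "?J \<subset> I" using i(1) psubset.prems(1) by blast
    then have "\<exists>P\<subseteq>?J. (\<forall>i\<in>P. \<forall>j\<in>P. i \<noteq> j \<longrightarrow> F i \<inter> F j = {}) \<and> (\<forall>j\<in>?J. F j \<inter> t ` P \<noteq> {})"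
      using psubset.prems by (intro psubset.IH) auto
    then obtain P where P: "P \<subseteq> ?J" "\<forall>i\<in>P. \<forall>j\<in>P. i \<noteq> j \<longrightarrow> F i \<inter> F j = {}"
        "\<forall>j\<in>?J. F j \<inter> t ` P \<noteq> {}"
      by auto
    have disj: "F i \<inter> F j = {}" if j: "j \<in> P" for j
    proof (rule ccontr)
      have "j \<in> I" "t i \<notin> F j" using j P(1) by auto
      moreover assume "F i \<inter> F j \<noteq> {}"
      ultimately show False using psubset.prems(2)[OF i(1)] i(2) by simp
    qed
    show ?thesis
    proof (intro exI[of _ "insert i P"] conjI)
      show "insert i P \<subseteq> I" using i(1) P(1) by blast
      show "\<forall>k\<in>insert i P. \<forall>j\<in>insert i P. k \<noteq> j \<longrightarrow> F k \<inter> F j = {}"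
        using disj P(2) by (auto simp: Int_commute)
      show "\<forall>j\<in>I. F j \<inter> t ` insert i P \<noteq> {}"
        using P(3) by blast
    qed
  qed simp
qed

section \<open>Rooting an undirected tree\<close>

text \<open>After the initial \<open>v\<close> the walk visits the vertices of the path and then
  \<open>v\<close>, all distinct, as \<open>cycle\<close> demands. For \<open>a = b\<close> and
  empty \<open>p\<close> this is a mere 2-cycle.\<close>

lemma (in pair_wf_digraph) cycle_of_apath:
  assumes "apath a p b" "v \<notin> set (awalk_verts a p)" "(v, a) \<in> parcs G" "(b, v) \<in> parcs G"
  shows "cycle ((v, a) # p @ [(b, v)])"
proof -
  have ab: "awalk a p b" "awlast a p = b" using assms(1) by (auto simp: apath_def)
  have w: "awalk a (p @ [(b, v)]) v"
    using ab assms(4) in_arcsD2[OF assms(4)] by (auto simp: awalk_simps)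
  then have "awalk v ((v, a) # p @ [(b, v)]) v"
    using assms(3) by (auto simp: awalk_Cons_iff)
  moreover have "awalk_verts a (p @ [(b, v)]) = awalk_verts a p @ [v]"
    using awalk_verts_append[OF w] ab by simp
  ultimately show ?thesis
    using assms(1,2) unfolding cycle_def by (intro exI[of _ v]) (auto simp: apath_def)
qed

text \<open>Parent and depth functions reduce later arguments to case distinctions on single arcs.
  The root stays unnamed, and \<open>p\<close> is unconstrained there.\<close>

lemma undirected_tree_parent_depth:
  assumes "undirected_tree G"
  obtains p :: "'a \<Rightarrow> 'a" and d :: "'a \<Rightarrow> nat"
  where "\<And>u v. (u, v) \<in> parcs G \<Longrightarrow>
    (u = p v \<and> d v = Suc (d u)) \<or> (v = p u \<and> d u = Suc (d v))"
proof -
  interpret pair_graph G using assms by (simp add: undirected_tree_def)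
  have conn: "Digraph_Component.connected (with_proj G)"
    and acyc: "\<And>c. cycle c \<Longrightarrow> length c < 3"
    using assms by (auto simp: undirected_tree_def not_le)
  have sym: "(u, v) \<in> parcs G \<Longrightarrow> (v, u) \<in> parcs G" for u v
    using sym_arcs by (auto simp: symmetric_def sym_def)
  have irr: "(u, u) \<notin> parcs G" for u
    using no_loops' by blast
  txt \<open>A largest linked and rooted vertex set is everything: a further vertex with an edge into the
    set has only one such neighbor, as two would close a cycle, so it can be hung below it.\<close>
  define linked where "linked W \<longleftrightarrow> W \<subseteq> pverts G \<and>
    (\<forall>a\<in>W. \<forall>b\<in>W. \<exists>q. apath a q b \<and> set (awalk_verts a q) \<subseteq> W)" for W
  define rooted where "rooted W p d \<longleftrightarrow> (\<forall>u\<in>W. \<forall>v\<in>W. (u, v) \<in> parcs G \<longrightarrow>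
    (u = p v \<and> d v = Suc (d u)) \<or> (v = p u \<and> d u = Suc (d v)))"
    for W and p :: "'a \<Rightarrow> 'a" and d :: "'a \<Rightarrow> nat"
  define Q where "Q W \<longleftrightarrow> W \<noteq> {} \<and> linked W \<and> (\<exists>p d. rooted W p d)" for W
  have sc: "strongly_connected (with_proj G)"
    using conn sym_arcs symmetric_connected_imp_strongly_connected by blast
  then obtain r where r: "r \<in> pverts G" by (auto simp: strongly_connected_def)
  \<comment> \<open>No arc lies within \<open>{r}\<close>, so any \<open>p\<close> and
    \<open>d\<close> root it.\<close>
  have "Q {r}"
    using r irr by (auto simp: Q_def linked_def rooted_def apath_Nil_iff intro!: exI[of _ "[]"])
  moreover have "\<forall>W. Q W \<longrightarrow> card W < Suc (card (pverts G))"
    by (auto simp: Q_def linked_def less_Suc_eq_le intro: card_mono)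
  ultimately obtain W where "Q W" and max: "\<And>W'. Q W' \<Longrightarrow> card W' \<le> card W"
    using ex_has_greatest_nat[of Q "{r}" card "Suc (card (pverts G))"] by metis
  then obtain p d where W: "W \<noteq> {}" "linked W" and pd: "rooted W p d"
    by (auto simp: Q_def)
  have sub: "W \<subseteq> pverts G" using W by (simp add: linked_def)
  have "W = pverts G"
  proof (rule ccontr)
    assume "W \<noteq> pverts G"
    with sub obtain y where y: "y \<in> pverts G" "y \<notin> W" by blast
    obtain x where x: "x \<in> W" using W by blast
    have "x \<rightarrow>\<^sup>*\<^bsub>with_proj G\<^esub> y" using sc x y sub by (auto simp: strongly_connected_def)
    \<comment> \<open>Otherwise everything reachable from \<open>x\<close>, including
      \<open>y\<close>, would lie in \<open>W\<close>.\<close>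
    have "\<exists>u v. u \<in> W \<and> v \<notin> W \<and> (u, v) \<in> parcs G"
    proof (rule ccontr)
      assume no: "\<not> ?thesis"
      from \<open>x \<rightarrow>\<^sup>*\<^bsub>with_proj G\<^esub> y\<close> have "y \<in> W"
        by (induction rule: reachable_induct) (use x no in auto)
      with y show False by blast
    qed
    then obtain u v where uv: "u \<in> W" "v \<notin> W" "(u, v) \<in> parcs G" by blast
    have v: "v \<in> pverts G" using uv by (metis in_arcsD2)
    have only: "b = u" if b: "b \<in> W" "(b, v) \<in> parcs G" for b
    proof (rule ccontr)
      assume "b \<noteq> u"
      obtain q where q: "apath u q b" "set (awalk_verts u q) \<subseteq> W"
        using W uv(1) b(1) unfolding linked_def by blast
      have "cycle ((v, u) # q @ [(b, v)])"
        using q uv(2) b(2) sym[OF uv(3)] by (intro cycle_of_apath) auto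
      \<comment> \<open>The cycle has two arcs besides those of \<open>q\<close>, and every cycle
        has fewer than three.\<close>
      from acyc[OF this] have "q = []" by simp
      with q(1) \<open>b \<noteq> u\<close> show False by (simp add: apath_Nil_iff)
    qed
    have "linked (insert v W)"
      unfolding linked_def
    proof (intro conjI ballI)
      show "insert v W \<subseteq> pverts G" using v sub by blast
      fix a b assume ab: "a \<in> insert v W" "b \<in> insert v W"
      have in_W: "\<exists>q. apath a q b \<and> set (awalk_verts a q) \<subseteq> W" if "a \<in> W" "b \<in> W" for a b
        using W that unfolding linked_def by blast
      \<comment> \<open>A path in \<open>W\<close> starting or ending at \<open>u\<close> is
        extended by one arc to \<open>v\<close>; it stays simple because \<open>v\<close> is outside
        \<open>W\<close>.\<close>
      consider "a = v" "b = v" | "a = v" "b \<in> W" | "a \<in> W" "b = v" | "a \<in> W" "b \<in> W"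
        using ab by blast
      then show "\<exists>q. apath a q b \<and> set (awalk_verts a q) \<subseteq> insert v W"
      proof cases
        case 1
        then show ?thesis using v by (intro exI[of _ "[]"]) (auto simp: apath_Nil_iff)
      next
        case 2
        with in_W uv(1) obtain q where q: "apath u q b" "set (awalk_verts u q) \<subseteq> W" by blast
        then have "apath v ((v, u) # q) b"
          using uv(2) sym[OF uv(3)] by (auto simp: apath_def awalk_Cons_iff)
        with q(2) 2 show ?thesis by (intro exI[of _ "(v, u) # q"]) auto
      next
        case 3
        with in_W uv(1) obtain q where q: "apath a q u" "set (awalk_verts a q) \<subseteq> W" by blast
        then have l: "awlast a q = u" by (auto simp: apath_def)
        have w: "awalk a (q @ [(u, v)]) v"
          using q l uv(3) v by (auto simp: awalk_simps apath_def)
        have "awalk_verts a (q @ [(u, v)]) = awalk_verts a q @ [v]"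
          using awalk_verts_append[OF w] l by simp
        with w q uv(2) 3 show ?thesis
          by (intro exI[of _ "q @ [(u, v)]"]) (auto simp: apath_def)
      next
        case 4
        with in_W show ?thesis by blast
      qed
    qed
    \<comment> \<open>Arcs within \<open>W\<close> do not see the change at \<open>v\<close>; by
      \<open>only\<close> and symmetry, any other arc joins \<open>u\<close> and
      \<open>v\<close>.\<close>
    moreover have "rooted (insert v W) (p(v := u)) (d(v := Suc (d u)))"
      unfolding rooted_def
    proof (intro ballI impI)
      fix a b assume ab: "a \<in> insert v W" "b \<in> insert v W" "(a, b) \<in> parcs G"
      have "a \<noteq> b" using ab(3) irr by blast
      then show "(a = (p(v := u)) b \<and> (d(v := Suc (d u))) b = Suc ((d(v := Suc (d u))) a)) \<or>
          (b = (p(v := u)) a \<and> (d(v := Suc (d u))) a = Suc ((d(v := Suc (d u))) b))"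
        using ab pd uv(2) only[of a] only[of b] sym[OF ab(3)] by (auto simp: rooted_def)
    qed
    ultimately have "Q (insert v W)" by (auto simp: Q_def)
    then have "card (insert v W) \<le> card W" by (rule max)
    moreover have "finite W" using finite_subset[OF sub] by simp
    ultimately show False using uv(2) by simp
  qed
  show thesis
  proof (rule that)
    fix u v assume uv: "(u, v) \<in> parcs G"
    then have "u \<in> W" "v \<in> W"
      using \<open>W = pverts G\<close> by (auto dest: in_arcsD1 in_arcsD2)
    then show "(u = p v \<and> d v = Suc (d u)) \<or> (v = p u \<and> d u = Suc (d v))"
      using pd uv unfolding rooted_def by blast
  qed
qed

section \<open>Domination and packing in digraphs\<close>

lemma (in pair_wf_digraph) dominating_iff_meets_closed_in_nbs:
  "dominating G S \<longleftrightarrow> S \<subseteq> pverts G \<and> (\<forall>x\<in>pverts G. closed_in_nbs G x \<inter> S \<noteq> {})"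
proof (cases "S \<subseteq> pverts G")
  case True
  have "x \<in> closed_out_nbs G v \<longleftrightarrow> v \<in> closed_in_nbs G x" if "x \<in> pverts G" "v \<in> S" for x v
    using that True by (auto simp: closed_out_nbs_def out_nbs_def closed_in_nbs_def in_nbs_def)
  moreover have "closed_out_nbs G v \<subseteq> pverts G" if "v \<in> S" for v
    using that True by (auto simp: closed_out_nbs_def out_nbs_def)
  ultimately show ?thesis
    using True unfolding dominating_def by blast
qed (simp add: dominating_def)

text \<open>Weak duality: choosing a vertex of \<open>S\<close> in each closed in-neighborhood of
  the packing is injective, as these neighborhoods are disjoint.\<close>

lemma (in pair_wf_digraph) card_packing_le_card_dominating:
  assumes "packing G P" "dominating G S" "finite S"
  shows "card P \<le> card S"
proof -
  have "\<forall>x\<in>P. \<exists>s. s \<in> closed_in_nbs G x \<inter> S"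
    using assms(1,2) by (auto simp: packing_def dominating_iff_meets_closed_in_nbs)
  then obtain s where s: "\<And>x. x \<in> P \<Longrightarrow> s x \<in> closed_in_nbs G x \<inter> S" by metis
  have "inj_on s P"
  proof (rule inj_onI, rule ccontr)
    fix x y assume xy: "x \<in> P" "y \<in> P" "s x = s y" "x \<noteq> y"
    then have "closed_in_nbs G x \<inter> closed_in_nbs G y = {}"
      using assms(1) by (simp add: packing_def)
    with s[OF xy(1)] s[OF xy(2)] xy(3) show False by auto
  qed
  then show ?thesis using s assms(3) by (intro card_inj_on_le[of s]) auto
qed

text \<open>The converse of weak duality for one suitable pair: \<open>P\<close> is the greedy
  packing and \<open>S\<close> the set of tops of its closed in-neighborhoods.\<close>

lemma ditree_dominating_packing:
  assumes "ditree T"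
  obtains P S where "packing T P" "dominating T S" "card S \<le> card P"
proof -
  interpret pair_digraph T using assms by (simp add: ditree_def)
  obtain p :: "'a \<Rightarrow> 'a" and d :: "'a \<Rightarrow> nat" where
    "\<And>u v. (u, v) \<in> parcs (mk_symmetric (with_proj T)) \<Longrightarrow>
      (u = p v \<and> d v = Suc (d u)) \<or> (v = p u \<and> d u = Suc (d v))"
    using assms undirected_tree_parent_depth by (metis ditree_def)
  then have pd: "(u = p v \<and> d v = Suc (d u)) \<or> (v = p u \<and> d u = Suc (d v))"
    if "(u, v) \<in> parcs T" for u v
    using that by (force simp: parcs_mk_symmetric)
  \<comment> \<open>The parent is the top exactly when it is an in-neighbor. The depth test matters
    at the root, where \<open>p\<close> might name a child.\<close>
  define t where "t x = (if (p x, x) \<in> parcs T \<and> d x = Suc (d (p x)) then p x else x)" for x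
  let ?F = "closed_in_nbs T"
  have F: "z \<in> ?F x \<longleftrightarrow> z = x \<or> (z, x) \<in> parcs T" for z x
    by (auto simp: closed_in_nbs_def in_nbs_def dest: in_arcsD1)
  have top: "t x \<in> ?F x" for x by (simp add: t_def F)
  have t_cases: "t x = x \<or> t x = p x \<and> d x = Suc (d (t x))" for x
    by (simp add: t_def)
  \<comment> \<open>An in-neighbor of \<open>x\<close> is its parent, then the top by definition, or
    a child.\<close>
  have F_cases: "z = t x \<or> z = x \<or> p z = x \<and> d z = Suc (d x)" if "z \<in> ?F x" for z x
  proof (cases "z = x")
    case False
    then have arc: "(z, x) \<in> parcs T" using that by (simp add: F)
    from pd[OF arc] show ?thesis
    proof
      assume "z = p x \<and> d x = Suc (d z)"
      then have "t x = z" using arc unfolding t_def by metis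
      then show ?thesis by simp
    qed auto
  qed simp
  have meet: "t i \<in> ?F j" if ij: "?F i \<inter> ?F j \<noteq> {}" "d (t j) \<le> d (t i)" for i j
  proof -
    obtain z where z: "z \<in> ?F i" "z \<in> ?F j" using ij(1) by blast
    consider "z = t i" | "z = i" "z \<noteq> t i" | "p z = i" "d z = Suc (d i)"
      using F_cases[OF z(1)] by blast
    then show ?thesis
    proof cases
      case 1
      then show ?thesis using z(2) by simp
    next
      case 2
      then have ti: "t i = p i" "d (t i) < d i" using t_cases[of i] by auto
      \<comment> \<open>Here \<open>i = t j\<close> contradicts the depths, \<open>i = j\<close> is
        trivial, and if \<open>i\<close> is a child of \<open>j\<close> then
        \<open>t i = p i = j\<close>.\<close>
      from F_cases[OF z(2)] show ?thesis
        using ti 2(1) ij(2) top[of j] F[of j j] by auto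
    next
      case 3
      have low: "d (t i) < d z" using t_cases[of i] 3(2) by auto
      \<comment> \<open>If \<open>z\<close> is a child of \<open>j\<close> as well as of
        \<open>i\<close>, both equal \<open>p z\<close>.\<close>
      from F_cases[OF z(2)] consider "z = t j" | "z = j" | "j = i" using 3(1) by blast
      then show ?thesis
      proof cases
        case 1
        then show ?thesis using low ij(2) by simp
      next
        case 2
        \<comment> \<open>The top of \<open>j\<close> is \<open>j\<close>, which is too deep, or its
          parent \<open>i\<close>; in the latter case \<open>t i\<close> cannot lie above
          \<open>i\<close>.\<close>
        then have "t j = i" using t_cases[of j] 3 low ij(2) by auto
        then have "t i = i" using t_cases[of i] ij(2) by auto
        then show ?thesis using top[of j] \<open>t j = i\<close> by simp
      next
        case 3
        then show ?thesis using top by simp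
      qed
    qed
  qed
  obtain P where P: "P \<subseteq> pverts T" "\<forall>i\<in>P. \<forall>j\<in>P. i \<noteq> j \<longrightarrow> ?F i \<inter> ?F j = {}"
      "\<forall>i\<in>pverts T. ?F i \<inter> t ` P \<noteq> {}"
    using disjoint_family_with_transversal[of "pverts T" t ?F d] top meet by auto
  have "t ` P \<subseteq> pverts T"
    using P(1) by (auto simp: t_def dest: in_arcsD1)
  with P have "packing T P" "dominating T (t ` P)"
    by (auto simp: packing_def dominating_iff_meets_closed_in_nbs)
  moreover have "card (t ` P) \<le> card P"
    using finite_subset[OF P(1)] by (simp add: card_image_le)
  ultimately show thesis by (rule that)
qed

theorem theorem1p2:
  fixes T :: "'a pair_pre_digraph"
  assumes "ditree T"
  shows "packing_number T = domination_number T"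
proof -
  interpret pair_digraph T using assms by (simp add: ditree_def)
  have dig: "pair_digraph T" by unfold_locales
  note fin = dominating_finite_nonempty[OF dig] packing_finite_nonempty[OF dig]
  obtain P S where PS: "packing T P" "dominating T S" "card S \<le> card P"
    using ditree_dominating_packing[OF assms] .
  have le: "card P' \<le> card S'" if "packing T P'" "dominating T S'" for P' S'
  proof (rule card_packing_le_card_dominating[OF that])
    show "finite S'" using that(2) finite_subset[OF _ finite_verts] by (auto simp: dominating_def)
  qed
  \<comment> \<open>Weak duality and \<open>card S \<le> card P\<close> together make
    \<open>S\<close> a smallest dominating set and \<open>P\<close> a largest packing.\<close>
  have "domination_number T = card S"
    unfolding domination_number_def
    using fin(1) PS(2) le[OF PS(1)] PS(3) by (intro Min_eqI) (auto intro: le_trans)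
  moreover have "packing_number T = card P"
    unfolding packing_number_def
    using fin(3) PS(1) le[OF _ PS(2)] PS(3) by (intro Max_eqI) (auto intro: le_trans)
  ultimately show ?thesis using PS le[OF PS(1,2)] by simp
qed

end
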